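(* Let $G$ and $H$ be finite graphs. If $c(G) \leq c(H)$, then $B(G\boxtimes H) \leq B(G)\left( B(H) + 1\right) + B(H) + c(G) - 1$.
   Context: The strong product $G\boxtimes H$ has vertex set $V(G)\times V(H)$, with distinct $(u,v)$ and $(x,y)$ adjacent iff either $ux \in E(G)$ and $v=y$, or $u=x$ and $vy\in E(H)$, or $ux \in E(G)$ and $vy\in E(H)$. The cop number $c(G)$ is the minimum number of cops that guarantees capture in the classical Cops and Robber game (cops placed first, then robber; alternating turns, cops first; each token moves to an adjacent vertex or stays; cops win if some cop occupies the robber's vertex). Bodyguards and Presidents is a two-player game on a finite simple graph $G$. One player controls a set of tokens called bodyguards, the other a single token called the president. First all bodyguards are placed on vertices (several may share a vertex), then the president is placed. The players then alternate turns, bodyguards first; on a player's turn, each token they control either moves to an adjacent vertex or stays put. The president is surrounded if every vertex of the open neighbourhood of the president's vertex is occupied by a bodyguard. The bodyguards win if there is a finite time after which, at the end of every bodyguard turn, the president is surrounded; otherwise the president wins. The bodyguard number $B(G)$ is the minimum number of bodyguards that guarantees a win for the bodyguards on $G$ (with $B(G)=0$ for the edgeless graph).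
   Formalization: G and H are additionally assumed connected (hence non-empty); for disconnected graphs the bound fails, e.g. G = K2 and H = two isolated vertices give B(G⊠H) = 2 while the bound is 1. *)

theory Defs
  imports "Graph_Theory.Graph_Theory"
begin

text \<open>
  A finite simple graph is a \<^locale>\<open>pair_graph\<close>: finitely many vertices, and an irreflexive,
  symmetric set of arcs, each edge being represented by its two orientations.
\<close>

definition strong_product ::
    "'a pair_pre_digraph \<Rightarrow> 'b pair_pre_digraph \<Rightarrow> ('a \<times> 'b) pair_pre_digraph"
    (infixl "\<boxtimes>" 70) where
  "G \<boxtimes> H = \<lparr> pverts = pverts G \<times> pverts H,
     parcs = {((u, v), (x, y)) | u v x y.
        (u, x) \<in> parcs G \<and> v \<in> pverts H \<and> v = y \<or>
        u \<in> pverts G \<and> u = x \<and> (v, y) \<in> parcs H \<or>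
        (u, x) \<in> parcs G \<and> (v, y) \<in> parcs H} \<rparr>"

lemma pair_graph_strong_product:
  assumes "pair_graph G" "pair_graph H"
  shows "pair_graph (G \<boxtimes> H)"
proof -
  interpret G: pair_graph G by fact
  interpret H: pair_graph H by fact
  have sub: "parcs (G \<boxtimes> H) \<subseteq> (pverts G \<times> pverts H) \<times> (pverts G \<times> pverts H)"
    by (auto simp: strong_product_def dest: G.in_arcsD1 G.in_arcsD2 H.in_arcsD1 H.in_arcsD2)
  have pv: "pverts (G \<boxtimes> H) = pverts G \<times> pverts H"
    by (simp add: strong_product_def)
  have fin: "finite (pverts G \<times> pverts H)"
    using G.pair_finite_verts H.pair_finite_verts by blast
  have symG: "(y, x) \<in> parcs G" if "(x, y) \<in> parcs G" for x y
    using G.pair_sym_arcs that by (auto simp: symmetric_def dest: symD)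
  have symH: "(y, x) \<in> parcs H" if "(x, y) \<in> parcs H" for x y
    using H.pair_sym_arcs that by (auto simp: symmetric_def dest: symD)
  show ?thesis
  proof
    show "\<And>e. e \<in> parcs (G \<boxtimes> H) \<Longrightarrow> fst e \<in> pverts (G \<boxtimes> H)"
      and "\<And>e. e \<in> parcs (G \<boxtimes> H) \<Longrightarrow> snd e \<in> pverts (G \<boxtimes> H)"
      using sub unfolding pv by auto
    show "finite (pverts (G \<boxtimes> H))" using fin unfolding pv .
    show "finite (parcs (G \<boxtimes> H))" using sub fin by (meson finite_SigmaI finite_subset)
    show "\<And>e. e \<in> parcs (G \<boxtimes> H) \<Longrightarrow> fst e \<noteq> snd e"
      using G.pair_no_loops H.pair_no_loops by (fastforce simp: strong_product_def)
    show "symmetric (with_proj (G \<boxtimes> H))"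
      unfolding symmetric_def sym_def
      by (auto simp: strong_product_def intro: symG symH)
  qed
qed

text \<open>
  In both games a team of \<open>k\<close> tokens (cops, resp. bodyguards) plays against a single token (robber,
  resp. president). A play of the single token is a sequence \<open>p\<close>, where \<open>p 0\<close> is its placement and
  \<open>p n\<close> its vertex after its \<open>n\<close>th turn. A configuration of the team is the list of the vertices of
  its tokens. A strategy maps the finite history of vertices the single token has occupied so far to
  the next configuration of the team; its value on the empty history is the initial placement, made
  before the single token is placed. So if the single token plays \<open>p\<close>, then \<open>team_conf \<sigma> p n\<close> is the
  configuration of the team at the end of its \<open>n\<close>th turn, when the single token is at
  \<open>p (n - 1)\<close> and is about to go to \<open>p n\<close>.
\<close>

definition stay_or_move :: "'a pair_pre_digraph \<Rightarrow> 'a \<Rightarrow> 'a \<Rightarrow> bool" where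
  "stay_or_move G u v \<longleftrightarrow> u \<in> pverts G \<and> (v = u \<or> (u, v) \<in> parcs G)"

definition legal_play :: "'a pair_pre_digraph \<Rightarrow> (nat \<Rightarrow> 'a) \<Rightarrow> bool" where
  "legal_play G p \<longleftrightarrow> p 0 \<in> pverts G \<and> (\<forall>n. stay_or_move G (p n) (p (Suc n)))"

definition team_conf :: "('a list \<Rightarrow> 'a list) \<Rightarrow> (nat \<Rightarrow> 'a) \<Rightarrow> nat \<Rightarrow> 'a list" where
  "team_conf \<sigma> p n = \<sigma> (map p [0..<n])"

definition legal_strategy :: "'a pair_pre_digraph \<Rightarrow> nat \<Rightarrow> ('a list \<Rightarrow> 'a list) \<Rightarrow> bool" where
  "legal_strategy G k \<sigma> \<longleftrightarrow> (\<forall>p. legal_play G p \<longrightarrow>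
     length (team_conf \<sigma> p 0) = k \<and> set (team_conf \<sigma> p 0) \<subseteq> pverts G \<and>
     (\<forall>n. list_all2 (stay_or_move G) (team_conf \<sigma> p n) (team_conf \<sigma> p (Suc n))))"

text \<open>
  In Cops and Robber, a capture takes place at the end of a robber turn (or his placement), or at
  the end of a cop turn. Plays are continued beyond the capture, which is harmless.
\<close>

definition cops_win :: "'a pair_pre_digraph \<Rightarrow> nat \<Rightarrow> bool" where
  "cops_win G k \<longleftrightarrow> (\<exists>\<sigma>. legal_strategy G k \<sigma> \<and> (\<forall>p. legal_play G p \<longrightarrow>
     (\<exists>n. p n \<in> set (team_conf \<sigma> p n) \<or> p n \<in> set (team_conf \<sigma> p (Suc n)))))"

definition cop_number :: "'a pair_pre_digraph \<Rightarrow> nat" where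
  "cop_number G = (LEAST k. cops_win G k)"

definition surrounded :: "'a pair_pre_digraph \<Rightarrow> 'a \<Rightarrow> 'a list \<Rightarrow> bool" where
  "surrounded G u bs \<longleftrightarrow> {v. (u, v) \<in> parcs G} \<subseteq> set bs"

definition bodyguards_win :: "'a pair_pre_digraph \<Rightarrow> nat \<Rightarrow> bool" where
  "bodyguards_win G k \<longleftrightarrow> (\<exists>\<sigma>. legal_strategy G k \<sigma> \<and> (\<forall>p. legal_play G p \<longrightarrow>
     (\<exists>N. \<forall>n\<ge>N. surrounded G (p n) (team_conf \<sigma> p (Suc n)))))"

text \<open>The edgeless graphs need no special treatment: there 0 bodyguards win vacuously.\<close>

definition bodyguard_number :: "'a pair_pre_digraph \<Rightarrow> nat" where
  "bodyguard_number G = (LEAST k. bodyguards_win G k)"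

end

theory Submission
  imports Defs
begin

text \<open>
  A move in a strong product is a pair of simultaneous moves in the factors, so the tokens play one
  game in \<open>G\<close> and one in \<open>H\<close>. Let \<open>k = B(G)\<close> and \<open>m = B(H)\<close>. Once a token catches the president in
  the projection to a factor it can shadow him there for ever. Letting \<open>c(G)\<close> free tokens at a time
  play the cop strategy, \<open>m + c(G) - 1\<close> tokens yield \<open>m\<close> shadows in \<open>G\<close>; the tokens that are left yield
  \<open>k\<close> further shadows in \<open>H\<close>. There are enough of them for this, since \<open>max 1 m\<close> tokens catch a robber
  in \<open>H\<close>: a surrounded robber cannot avoid being adjacent to a token. At least \<open>km\<close> tokens remain without a
  task. All tokens go to the starting positions of the bodyguard strategies in the coordinates in
  which they do not shadow, and the strategies are started from there: the shadows in \<open>G\<close> play the \<open>m\<close>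
  bodyguards of \<open>H\<close> and guard \<open>{u} \<times> N(v)\<close>, the shadows in \<open>H\<close> play the \<open>k\<close> bodyguards of \<open>G\<close> and guard
  \<open>N(u) \<times> {v}\<close>, and \<open>km\<close> of the others play all pairs of bodyguards and guard \<open>N(u) \<times> N(v)\<close>.
\<close>

section \<open>Forcing in abstract pursuit games\<close>

text \<open>It is the team's turn at \<open>(c, u)\<close>. Being a least fixed point, the predicate
  means that the team reaches \<open>Q\<close> after finitely many rounds. It depends on the
  position alone, so phases of play can be chained without carrying histories along.\<close>

inductive forces ::
    "('c \<Rightarrow> 'c \<Rightarrow> bool) \<Rightarrow> ('p \<Rightarrow> 'p \<Rightarrow> bool) \<Rightarrow> ('c \<Rightarrow> 'p \<Rightarrow> bool) \<Rightarrow> 'c \<Rightarrow> 'p \<Rightarrow> bool"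
  for mv pm Q where
    now: "Q c u \<Longrightarrow> forces mv pm Q c u"
  | later: "mv c c' \<Longrightarrow> (\<And>u'. pm u u' \<Longrightarrow> forces mv pm Q c' u') \<Longrightarrow> forces mv pm Q c u"

lemma forces_trans:
  assumes "forces mv pm P c u" and "\<And>c u. P c u \<Longrightarrow> forces mv pm Q c u"
  shows "forces mv pm Q c u"
  using assms(1) by induction (auto intro: assms(2) forces.later)

lemma forces_mono:
  assumes "forces mv pm P c u" and "\<And>c u. P c u \<Longrightarrow> Q c u"
  shows "forces mv pm Q c u"
  using forces_trans[OF assms(1)] assms(2) forces.now by metis

text \<open>The team imitates an auxiliary game that it can force, with \<open>rel\<close> as
  invariant: each auxiliary team move is matched by a real one, and each real reply of the opponent
  is read back as an auxiliary reply.\<close>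

lemma forces_simulation:
  assumes "forces mv1 pm1 Q c1 u1" and "rel c u c1 u1"
    and step: "\<And>c u c1 u1 c1'. rel c u c1 u1 \<Longrightarrow> mv1 c1 c1' \<Longrightarrow>
      \<exists>c'. mv c c' \<and> (\<forall>u'. pm u u' \<longrightarrow> (\<exists>u1'. pm1 u1 u1' \<and> rel c' u' c1' u1'))"
  shows "forces mv pm (\<lambda>c u. \<exists>c1 u1. Q c1 u1 \<and> rel c u c1 u1) c u"
  using assms(1,2)
proof (induction arbitrary: c u)
  case (now c1 u1)
  then show ?case by (auto intro: forces.now)
next
  case (later c1 c1' u1)
  from step[OF later.prems later.hyps(1)] obtain c' where "mv c c'"
    and c': "\<And>u'. pm u u' \<Longrightarrow> \<exists>u1'. pm1 u1 u1' \<and> rel c' u' c1' u1'" by blast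
  show ?case
  proof (rule forces.later)
    show "mv c c'" by fact
    fix u' assume "pm u u'"
    with c' obtain u1' where "pm1 u1 u1'" "rel c' u' c1' u1'" by blast
    then show "forces mv pm (\<lambda>c u. \<exists>c1 u1. Q c1 u1 \<and> rel c u c1 u1) c' u'"
      by (rule later.IH)
  qed
qed

text \<open>The goal \<open>R\<close> has to hold from some time on after every team turn, and the
  given bodyguard strategies use histories; hence \<open>\<tau>\<close> sees the vertices since the
  current one, \<open>u\<close>. The configuration \<open>c\<close> precedes its first
  answer.\<close>

definition wins ::
    "('c \<Rightarrow> 'c \<Rightarrow> bool) \<Rightarrow> ('p \<Rightarrow> 'p \<Rightarrow> bool) \<Rightarrow> ('p \<Rightarrow> 'c \<Rightarrow> bool) \<Rightarrow> 'c \<Rightarrow> 'p \<Rightarrow> bool" where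
  "wins mv pm R c u \<longleftrightarrow> (\<exists>\<tau>. \<forall>p. p 0 = u \<longrightarrow> (\<forall>n. pm (p n) (p (Suc n))) \<longrightarrow>
     mv c (\<tau> [u]) \<and>
     (\<forall>n. mv (\<tau> (map p [0..<Suc n])) (\<tau> (map p [0..<Suc (Suc n)]))) \<and>
     (\<exists>N. \<forall>n\<ge>N. R (p n) (\<tau> (map p [0..<Suc n]))))"

lemma map_upt_Suc_shift: "map p [0..<Suc n] = p 0 # map (\<lambda>i. p (Suc i)) [0..<n]"
  by (simp add: map_upt_Suc del: upt_Suc)

lemma wins_step:
  assumes mv: "mv c c'" and w: "\<And>u'. pm u u' \<Longrightarrow> wins mv pm R c' u'"
  shows "wins mv pm R c u"
proof -
  have "\<exists>T. \<forall>u'. pm u u' \<longrightarrow> (\<forall>p. p 0 = u' \<longrightarrow> (\<forall>n. pm (p n) (p (Suc n))) \<longrightarrow>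
     mv c' (T u' [u']) \<and>
     (\<forall>n. mv (T u' (map p [0..<Suc n])) (T u' (map p [0..<Suc (Suc n)]))) \<and>
     (\<exists>N. \<forall>n\<ge>N. R (p n) (T u' (map p [0..<Suc n]))))"
    using w unfolding wins_def by (intro choice) blast
  then obtain T where T: "\<And>u' p. pm u u' \<Longrightarrow> p 0 = u' \<Longrightarrow> (\<And>n. pm (p n) (p (Suc n))) \<Longrightarrow>
     mv c' (T u' [u']) \<and>
     (\<forall>n. mv (T u' (map p [0..<Suc n])) (T u' (map p [0..<Suc (Suc n)]))) \<and>
     (\<exists>N. \<forall>n\<ge>N. R (p n) (T u' (map p [0..<Suc n])))" by metis
  \<comment> \<open>The first answer is \<open>c'\<close>. Later the initial vertex is dropped, and
    the opponent's reply, now the head, selects the strategy to continue with.\<close>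
  define \<tau> where "\<tau> h = (if length h \<le> 1 then c' else T (hd (tl h)) (tl h))" for h
  show ?thesis
    unfolding wins_def
  proof (intro exI[of _ \<tau>] allI impI)
    fix p assume p0: "p 0 = u" and p: "\<forall>n. pm (p n) (p (Suc n))"
    define q where "q = (\<lambda>i. p (Suc i))"
    have "pm u (q 0)" using p p0 by (auto simp: q_def)
    from T[OF this, of q] p have q:
      "mv c' (T (q 0) [q 0])"
      "\<And>n. mv (T (q 0) (map q [0..<Suc n])) (T (q 0) (map q [0..<Suc (Suc n)]))"
      "\<exists>N. \<forall>n\<ge>N. R (q n) (T (q 0) (map q [0..<Suc n]))"
      by (auto simp: q_def simp del: upt_Suc)
    have tau1: "\<tau> [u'] = c'" for u' by (simp add: \<tau>_def)
    have tau2: "\<tau> (map p [0..<Suc (Suc n)]) = T (q 0) (map q [0..<Suc n])" for n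
    proof -
      have "map p [0..<Suc (Suc n)] = p 0 # map q [0..<Suc n]"
        unfolding q_def by (rule map_upt_Suc_shift)
      moreover have "hd (map q [0..<Suc n]) = q 0" by (subst map_upt_Suc_shift) simp
      ultimately show ?thesis by (simp add: \<tau>_def del: upt_Suc)
    qed
    have "mv (\<tau> (map p [0..<Suc n])) (\<tau> (map p [0..<Suc (Suc n)]))" for n
    proof (cases n)
      case 0
      then show ?thesis using q(1) tau2[of 0] by (simp add: tau1)
    next
      case (Suc l)
      then show ?thesis using q(2)[of l] by (simp only: tau2)
    qed
    moreover from q(3) obtain N where N: "\<And>n. n \<ge> N \<Longrightarrow> R (q n) (T (q 0) (map q [0..<Suc n]))"
      by blast
    have "R (p n) (\<tau> (map p [0..<Suc n]))" if n: "n \<ge> Suc N" for n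
    proof -
      from n obtain l where l: "n = Suc l" "l \<ge> N" by (cases n) auto
      show ?thesis using N[OF l(2)] unfolding l(1) tau2 by (simp only: q_def)
    qed
    ultimately show "mv c (\<tau> [u]) \<and>
        (\<forall>n. mv (\<tau> (map p [0..<Suc n])) (\<tau> (map p [0..<Suc (Suc n)]))) \<and>
        (\<exists>N. \<forall>n\<ge>N. R (p n) (\<tau> (map p [0..<Suc n])))"
      using mv by (auto simp: tau1 simp del: upt_Suc)
  qed
qed

text \<open>A finite preparatory phase does not affect a goal that only has to hold eventually; each
  round of it is prepended by \<open>wins_step\<close>.\<close>

lemma forces_wins:
  assumes "forces mv pm Q c u" and "\<And>c u. Q c u \<Longrightarrow> wins mv pm R c u"
  shows "wins mv pm R c u"
  using assms(1) by induction (auto intro: assms(2) wins_step)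

lemma wins_mono:
  assumes "wins mv pm R c u" and "\<And>u c. R u c \<Longrightarrow> R' u c"
  shows "wins mv pm R' c u"
  using assms(1) unfolding wins_def
  by (elim ex_forward all_forward imp_forward conj_forward) (auto intro: assms(2) simp del: upt_Suc)

section \<open>Shadowing and relocating tokens in one graph\<close>

text \<open>Positions are indexed by all natural numbers, so that the size of the team only enters through
  the finitely many tokens that are given a task.\<close>

definition moves :: "'a pair_pre_digraph \<Rightarrow> (nat \<Rightarrow> 'a) \<Rightarrow> (nat \<Rightarrow> 'a) \<Rightarrow> bool" where
  "moves G f f' \<longleftrightarrow> (\<forall>i. stay_or_move G (f i) (f' i))"

abbreviation "forces_on G \<equiv> forces (moves G) (stay_or_move G)"
abbreviation "wins_on G \<equiv> wins (moves G) (stay_or_move G)"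

text \<open>It is the team's turn: the tokens in \<open>S\<close> can step onto the vertex \<open>u\<close> of the opponent, and can
  then do so again on all later turns.\<close>

definition shadowed :: "'a pair_pre_digraph \<Rightarrow> nat set \<Rightarrow> (nat \<Rightarrow> 'a) \<Rightarrow> 'a \<Rightarrow> bool" where
  "shadowed G S f u \<longleftrightarrow> (\<forall>i. f i \<in> pverts G) \<and> u \<in> pverts G \<and> (\<forall>i\<in>S. stay_or_move G (f i) u)"

text \<open>One placement must serve against all vertices of the opponent. The goal is that some
  token among the first \<open>d\<close> is about to step onto the opponent, which is exactly what
  admits it to the set in \<open>shadowed\<close>.\<close>

definition pursuit :: "'a pair_pre_digraph \<Rightarrow> nat \<Rightarrow> bool" where
  "pursuit G d \<longleftrightarrow> (\<exists>f. (\<forall>i. f i \<in> pverts G) \<and>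
     (\<forall>u\<in>pverts G. forces_on G (\<lambda>f u. \<exists>i<d. stay_or_move G (f i) u) f u))"

section \<open>Elementary facts on moves, arcs and connectivity\<close>

lemma stay_or_move_refl: "u \<in> pverts G \<Longrightarrow> stay_or_move G u u"
  by (simp add: stay_or_move_def)

lemma stay_or_move_verts:
  assumes "pair_graph G" "stay_or_move G u v"
  shows "u \<in> pverts G" "v \<in> pverts G"
proof -
  interpret pair_graph G by fact
  show "u \<in> pverts G" "v \<in> pverts G"
    using assms(2) in_arcsD2[of u v] by (auto simp: stay_or_move_def)
qed

lemma parcs_sym:
  assumes "pair_graph G" "(u, v) \<in> parcs G"
  shows "(v, u) \<in> parcs G"
proof -
  interpret pair_graph G by fact
  show ?thesis using pair_sym_arcs assms(2) by (auto simp: symmetric_def dest: symD)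
qed

lemma parcs_verts:
  assumes "pair_graph G" "(u, v) \<in> parcs G"
  shows "u \<in> pverts G" "v \<in> pverts G"
proof -
  interpret pair_graph G by fact
  show "u \<in> pverts G" "v \<in> pverts G"
    using assms(2) in_arcsD1[of u v] in_arcsD2[of u v] by auto
qed

lemma connected_rtrancl:
  assumes "pair_graph G" "Digraph_Component.connected (with_proj G)"
    and "u \<in> pverts G" "v \<in> pverts G"
  shows "(u, v) \<in> (parcs G)\<^sup>*"
proof -
  interpret pair_graph G by fact
  have "strongly_connected (with_proj (mk_symmetric (with_proj G)))"
    using assms(2) unfolding Digraph_Component.connected_def .
  then have "(u, v) \<in> rtrancl_on (pverts G) (parcs (mk_symmetric (with_proj G)))"
    using assms(3,4) by (auto simp: strongly_connected_def reachable_def)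
  then have "(u, v) \<in> (parcs (mk_symmetric (with_proj G)))\<^sup>*"
    by (rule rtrancl_on_rtranclI)
  moreover have "parcs (mk_symmetric (with_proj G)) \<subseteq> parcs G"
    using parcs_sym[OF assms(1)] by (auto simp: mk_symmetric_def)
  ultimately show ?thesis using rtrancl_mono by blast
qed

lemma connected_nonempty:
  "Digraph_Component.connected (with_proj G) \<Longrightarrow> pverts G \<noteq> {}"
  by (auto simp: Digraph_Component.connected_def strongly_connected_def)

section \<open>Recruiting shadows and moving the other tokens meanwhile\<close>

lemma shadowed_maintain:
  assumes G: "pair_graph G" and sh: "shadowed G S f u"
  shows "\<exists>f'. moves G f f' \<and> (\<forall>i. i \<notin> S \<longrightarrow> f' i = f i) \<and>
    (\<forall>u'. stay_or_move G u u' \<longrightarrow> shadowed G S f' u')"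
proof (intro exI conjI)
  \<comment> \<open>The shadows step onto \<open>u\<close>, so any move of the opponent from there
    can be copied on the next turn; all other tokens wait.\<close>
  let ?f = "\<lambda>i. if i \<in> S then u else f i"
  show "moves G f ?f" using sh by (auto simp: moves_def shadowed_def stay_or_move_refl)
  show "\<forall>u'. stay_or_move G u u' \<longrightarrow> shadowed G S ?f u'"
    using sh stay_or_move_verts[OF G] by (auto simp: shadowed_def)
qed simp

text \<open>Token \<open>i\<close> walks along a path from \<open>x\<close> to \<open>y\<close>
  while \<open>S\<close> keeps shadowing. The clause that the remaining tokens stand still lets
  tokens be relocated one after another without losing those already in place.\<close>

lemma forces_relocate_one:
  assumes G: "pair_graph G" and i: "i \<notin> S" and "(x, y) \<in> (parcs G)\<^sup>*"
    and "shadowed G S f u" "f i = x"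
  shows "forces_on G (\<lambda>f' u. shadowed G S f' u \<and> (\<forall>j. j \<notin> insert i S \<longrightarrow> f' j = f j) \<and> f' i = y) f u"
  using assms(3-)
proof (induction arbitrary: f u rule: converse_rtrancl_induct)
  case base
  then show ?case by (intro forces.now) auto
next
  case (step x z)
  from shadowed_maintain[OF G step.prems(1)] obtain f' where f':
    "moves G f f'" "\<And>j. j \<notin> S \<Longrightarrow> f' j = f j"
    "\<And>u'. stay_or_move G u u' \<Longrightarrow> shadowed G S f' u'" by blast
  let ?f = "f'(i := z)"
  have z: "x \<in> pverts G" "z \<in> pverts G" using parcs_verts[OF G step.hyps(1)] .
  show ?case
  proof (rule forces.later)
    show "moves G f ?f"
      using f'(1) step.prems(2) step.hyps(1) z by (auto simp: moves_def stay_or_move_def)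
    fix u' assume "stay_or_move G u u'"
    from f'(3)[OF this] have "shadowed G S ?f u'" using i z by (auto simp: shadowed_def)
    from step.IH[OF this fun_upd_same] show "forces_on G
        (\<lambda>f' u. shadowed G S f' u \<and> (\<forall>j. j \<notin> insert i S \<longrightarrow> f' j = f j) \<and> f' i = y) ?f u'"
      by (rule forces_mono) (auto simp: f'(2))
  qed
qed

lemma forces_relocate:
  assumes G: "pair_graph G" "Digraph_Component.connected (with_proj G)"
    and "finite A" "A \<inter> S = {}" "\<And>i. i \<in> A \<Longrightarrow> t i \<in> pverts G"
    and "shadowed G S f u"
  shows "forces_on G (\<lambda>f u. shadowed G S f u \<and> (\<forall>i\<in>A. f i = t i)) f u"
  using assms(3-)
proof (induction A arbitrary: f u)
  case empty
  then show ?case by (auto intro: forces.now)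
next
  case (insert a A)
  have "forces_on G (\<lambda>f u. shadowed G S f u \<and> (\<forall>i\<in>A. f i = t i)) f u"
    using insert by auto
  then show ?case
  proof (rule forces_trans)
    fix f u assume *: "shadowed G S f u \<and> (\<forall>i\<in>A. f i = t i)"
    then have "(f a, t a) \<in> (parcs G)\<^sup>*"
      using connected_rtrancl[OF G] insert.prems by (auto simp: shadowed_def)
    from forces_relocate_one[OF G(1) _ this, of a S f u] * insert.prems
    have "forces_on G (\<lambda>f' u. shadowed G S f' u \<and> (\<forall>j. j \<notin> insert a S \<longrightarrow> f' j = f j) \<and> f' a = t a) f u"
      by auto
    then show "forces_on G (\<lambda>f u. shadowed G S f u \<and> (\<forall>i\<in>insert a A. f i = t i)) f u"
    proof (rule forces_mono)
      fix f' u'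
      assume f': "shadowed G S f' u' \<and> (\<forall>j. j \<notin> insert a S \<longrightarrow> f' j = f j) \<and> f' a = t a"
      have "f' i = t i" if "i \<in> A" for i
        using f' * that insert.hyps(2) insert.prems(1) by (metis disjoint_iff insert_iff)
      then show "shadowed G S f' u' \<and> (\<forall>i\<in>insert a A. f' i = t i)" using f' by auto
    qed
  qed
qed

text \<open>Connectivity lets \<open>d\<close> tokens of \<open>T\<close> travel to the starting
  positions of the pursuit and then play it, while \<open>S\<close> keeps shadowing. The token that
  catches the opponent joins \<open>S\<close>.\<close>

lemma forces_shadow_one_more:
  assumes G: "pair_graph G" "Digraph_Component.connected (with_proj G)" and d: "pursuit G d"
    and T: "finite T" "d \<le> card T" "S \<inter> T = {}" and sh: "shadowed G S f u"
  shows "forces_on G (\<lambda>f u. \<exists>i\<in>T. shadowed G (insert i S) f u) f u"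
proof -
  from d obtain f0 where f0: "\<And>i. f0 i \<in> pverts G"
    and pursue: "\<And>u. u \<in> pverts G \<Longrightarrow> forces_on G (\<lambda>f u. \<exists>i<d. stay_or_move G (f i) u) f0 u"
    unfolding pursuit_def by blast
  \<comment> \<open>\<open>\<iota>\<close> casts \<open>d\<close> tokens of \<open>T\<close> as the
    tokens below \<open>d\<close> of the pursuit; \<open>the_inv_into\<close> below recovers the
    part that a token plays.\<close>
  from T obtain \<iota> where \<iota>: "\<iota> ` {..<d} \<subseteq> T" "inj_on \<iota> {..<d}"
    using card_le_inj[of "{..<d}" T] by auto
  let ?A = "\<iota> ` {..<d}"
  have "forces_on G (\<lambda>f u. shadowed G S f u \<and> (\<forall>i\<in>?A. f i = f0 (the_inv_into {..<d} \<iota> i))) f u"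
    using \<iota>(1) T(3) f0 sh by (intro forces_relocate G) auto
  then show ?thesis
  proof (rule forces_trans)
    fix f u assume *: "shadowed G S f u \<and> (\<forall>i\<in>?A. f i = f0 (the_inv_into {..<d} \<iota> i))"
    \<comment> \<open>Both games share the same opponent, and token \<open>\<iota> j\<close> stands
      where token \<open>j\<close> of the pursuit stands.\<close>
    let ?rel = "\<lambda>f u g v. shadowed G S f u \<and> v = u \<and> (\<forall>j<d. f (\<iota> j) = g j)"
    have "forces_on G (\<lambda>f u. \<exists>g v. (\<exists>i<d. stay_or_move G (g i) v) \<and> ?rel f u g v) f u"
    proof (rule forces_simulation)
      show "forces_on G (\<lambda>f u. \<exists>i<d. stay_or_move G (f i) u) f0 u"
        using * by (intro pursue) (auto simp: shadowed_def)
      show "?rel f u f0 u" using * \<iota>(2) by (auto simp: the_inv_into_f_f)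
      fix f u g v g' assume rel: "?rel f u g v" and mv: "moves G g g'"
      from shadowed_maintain[OF G(1)] rel obtain f' where f':
        "moves G f f'" "\<And>j. j \<notin> S \<Longrightarrow> f' j = f j"
        "\<And>u'. stay_or_move G u u' \<Longrightarrow> shadowed G S f' u'" by blast
      define f'' where "f'' = (\<lambda>i. if i \<in> ?A then g' (the_inv_into {..<d} \<iota> i) else f' i)"
      have A: "f'' (\<iota> j) = g' j" if "j < d" for j
        using that \<iota>(2) by (auto simp: f''_def the_inv_into_f_f)
      have mv'': "moves G f f''"
        unfolding moves_def
      proof
        fix i
        show "stay_or_move G (f i) (f'' i)"
        proof (cases "i \<in> ?A")
          case True
          then obtain j where j: "i = \<iota> j" "j < d" by auto
          then show ?thesis using A[OF j(2)] rel mv by (auto simp: moves_def)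
        next
          case False
          then show ?thesis using f'(1) by (auto simp: f''_def moves_def)
        qed
      qed
      have "shadowed G S f'' u'" if "stay_or_move G u u'" for u'
      proof -
        have "f'' i \<in> pverts G" for i
          using mv'' stay_or_move_verts[OF G(1)] unfolding moves_def by blast
        moreover have "f'' i = f' i" if "i \<in> S" for i
          using that \<iota>(1) T(3) by (auto simp: f''_def)
        ultimately show ?thesis using f'(3)[OF that] by (auto simp: shadowed_def)
      qed
      then show "\<exists>f'. moves G f f' \<and> (\<forall>u'. stay_or_move G u u' \<longrightarrow>
          (\<exists>v'. stay_or_move G v v' \<and> ?rel f' u' g' v'))"
        using mv'' A rel by (intro exI[of _ f'']) auto
    qed
    then show "forces_on G (\<lambda>f u. \<exists>i\<in>T. shadowed G (insert i S) f u) f u"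
    proof (rule forces_mono)
      fix f u assume "\<exists>g v. (\<exists>i<d. stay_or_move G (g i) v) \<and> ?rel f u g v"
      then obtain j where "j < d" "stay_or_move G (f (\<iota> j)) u" "shadowed G S f u" by auto
      then show "\<exists>i\<in>T. shadowed G (insert i S) f u"
        using \<iota>(1) by (intro bexI[of _ "\<iota> j"]) (auto simp: shadowed_def)
    qed
  qed
qed

text \<open>Shadows are recruited one at a time. Before the last one, \<open>m - 1\<close> tokens of
  \<open>U\<close> are busy, and at least \<open>d\<close> must still be free; this is the bound for
  \<open>m > 0\<close>.\<close>

lemma forces_shadow_team:
  assumes G: "pair_graph G" "Digraph_Component.connected (with_proj G)" and d: "pursuit G d"
    and U: "finite U" and sh: "shadowed G {} f u" and "m = 0 \<or> m + d \<le> card U + 1"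
  shows "forces_on G (\<lambda>f u. \<exists>S\<subseteq>U. card S = m \<and> shadowed G S f u) f u"
  using assms(6)
proof (induction m)
  case 0
  then show ?case using sh by (intro forces.now) auto
next
  case (Suc m)
  then have "forces_on G (\<lambda>f u. \<exists>S\<subseteq>U. card S = m \<and> shadowed G S f u) f u" by auto
  then show ?case
  proof (rule forces_trans)
    fix f u assume "\<exists>S\<subseteq>U. card S = m \<and> shadowed G S f u"
    then obtain S where S: "S \<subseteq> U" "card S = m" "shadowed G S f u" by blast
    have "finite S" using S(1) U finite_subset by blast
    then have "d \<le> card (U - S)" using Suc.prems S by (simp add: card_Diff_subset)
    from forces_shadow_one_more[OF G d _ this _ S(3)] U
    have "forces_on G (\<lambda>f u. \<exists>i\<in>U - S. shadowed G (insert i S) f u) f u" by auto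
    then show "forces_on G (\<lambda>f u. \<exists>S\<subseteq>U. card S = Suc m \<and> shadowed G S f u) f u"
    proof (rule forces_mono)
      fix f u assume "\<exists>i\<in>U - S. shadowed G (insert i S) f u"
      then obtain i where "i \<in> U - S" "shadowed G (insert i S) f u" by blast
      then show "\<exists>S\<subseteq>U. card S = Suc m \<and> shadowed G S f u"
        using S \<open>finite S\<close> by (intro exI[of _ "insert i S"]) auto
    qed
  qed
qed

section \<open>Positions reached by history-dependent strategies\<close>

definition legal_history :: "'a pair_pre_digraph \<Rightarrow> 'a list \<Rightarrow> bool" where
  "legal_history G h \<longleftrightarrow> h \<noteq> [] \<and> (\<forall>i<length h. h ! i \<in> pverts G) \<and>
     (\<forall>i. Suc i < length h \<longrightarrow> stay_or_move G (h ! i) (h ! Suc i))"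

lemma legal_history_snoc:
  assumes "pair_graph G" "legal_history G h" "stay_or_move G (last h) v"
  shows "legal_history G (h @ [v])"
  using assms(2,3) stay_or_move_verts[OF assms(1,3)]
  by (auto simp: legal_history_def nth_append last_conv_nth less_Suc_eq)
    (metis One_nat_def diff_Suc_1)

text \<open>The opponent stands still after the end of \<open>h\<close>. This makes
  \<open>legal_strategy\<close>, which speaks of infinite plays, applicable to finite
  histories.\<close>

lemma legal_history_extends:
  assumes "legal_history G h"
  obtains p where "legal_play G p" "map p [0..<length h] = h"
proof
  let ?p = "\<lambda>i. if i < length h then h ! i else last h"
  have l: "last h = h ! (length h - 1)" "length h > 0"
    using assms by (auto simp: legal_history_def last_conv_nth)
  show "map ?p [0..<length h] = h" by (rule nth_equalityI) auto
  have "stay_or_move G (?p n) (?p (Suc n))" for n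
  proof -
    consider "Suc n < length h" | "Suc n = length h" | "n \<ge> length h" by linarith
    then show ?thesis
    proof cases
      case 2
      then have "last h = h ! n" by (simp add: l flip: 2)
      then show ?thesis using 2 assms by (auto simp: legal_history_def stay_or_move_refl)
    qed (use assms l in \<open>auto simp: legal_history_def stay_or_move_refl\<close>)
  qed
  then show "legal_play G ?p" using assms l by (auto simp: legal_play_def legal_history_def)
qed

lemma legal_strategy_length:
  assumes "legal_strategy G k \<sigma>" "legal_play G p"
  shows "length (team_conf \<sigma> p n) = k"
proof (induction n)
  case 0
  then show ?case using assms by (auto simp: legal_strategy_def)
next
  case (Suc n)
  then show ?case using assms list_all2_lengthD unfolding legal_strategy_def by metis
qed

lemma legal_strategy_step:
  assumes "legal_strategy G k \<sigma>" "legal_play G p" "i < k"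
  shows "stay_or_move G (team_conf \<sigma> p n ! i) (team_conf \<sigma> p (Suc n) ! i)"
proof -
  have "list_all2 (stay_or_move G) (team_conf \<sigma> p n) (team_conf \<sigma> p (Suc n))"
    using assms(1,2) by (auto simp: legal_strategy_def)
  then show ?thesis using assms(3) legal_strategy_length[OF assms(1,2)]
    by (auto intro: list_all2_nthD)
qed

lemma legal_strategy_start:
  assumes "legal_strategy G k \<sigma>" "pverts G \<noteq> {}" "i < k"
  shows "\<sigma> [] ! i \<in> pverts G"
proof -
  from assms(2) obtain u where "u \<in> pverts G" by blast
  then have "legal_play G (\<lambda>_. u)" by (simp add: legal_play_def stay_or_move_refl)
  then have "length (\<sigma> []) = k" "set (\<sigma> []) \<subseteq> pverts G"
    using assms(1) by (auto simp: legal_strategy_def team_conf_def)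
  then show ?thesis using assms(3) by auto
qed

text \<open>An opponent outside the region from which a capture is forced can stay outside it for ever, whatever
  the team plays, and would thereby beat \<open>\<sigma>\<close>.\<close>

lemma pursuit_if_strategy:
  assumes G: "pair_graph G" "pverts G \<noteq> {}" and \<sigma>: "legal_strategy G k \<sigma>"
    and reach: "\<And>p. legal_play G p \<Longrightarrow> \<exists>n. \<exists>i<k. stay_or_move G (team_conf \<sigma> p n ! i) (p n)"
  shows "pursuit G k"
proof -
  let ?Q = "\<lambda>f u. \<exists>i<k. stay_or_move G (f i) u"
  from G(2) obtain z where z: "z \<in> pverts G" by blast
  \<comment> \<open>Tokens with index \<open>k\<close> or more do not belong to the team of
    \<open>\<sigma>\<close> and are parked at \<open>z\<close>.\<close>
  define c where "c h i = (if i < k then \<sigma> h ! i else z)" for h i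
  have step: "moves G (c (butlast h)) (c h)" if lh: "legal_history G h" for h
  proof -
    obtain p where p: "legal_play G p" "map p [0..<length h] = h"
      using legal_history_extends[OF lh] by blast
    have "h \<noteq> []" using lh by (simp add: legal_history_def)
    then obtain n where n: "length h = Suc n" by (cases h) auto
    have "h = map p [0..<Suc n]" using p(2) n by simp
    then have "team_conf \<sigma> p n = \<sigma> (butlast h)" "team_conf \<sigma> p (Suc n) = \<sigma> h"
      by (simp_all add: team_conf_def)
    then show ?thesis
      using legal_strategy_step[OF \<sigma> p(1), of _ n] z
      by (simp add: moves_def c_def stay_or_move_refl)
  qed
  have "forces_on G ?Q (c []) u" if u: "u \<in> pverts G" for u
  proof (rule ccontr)
    assume not: "\<not> forces_on G ?Q (c []) u"
    let ?P = "\<lambda>n h. length h = Suc n \<and> legal_history G h \<and> \<not> forces_on G ?Q (c (butlast h)) (last h)"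
    \<comment> \<open>If all replies led to forced positions, \<open>forces.later\<close> would make
      the present position forced as well. So an escaping reply always exists, and dependent choice
      strings these replies together to an infinite play.\<close>
    have "\<exists>h. \<forall>n. ?P n (h n) \<and> (\<exists>v. h (Suc n) = h n @ [v])"
    proof (rule dependent_nat_choice)
      show "\<exists>h. ?P 0 h"
        using u not by (intro exI[of _ "[u]"]) (auto simp: legal_history_def)
      fix h n assume h: "?P n h"
      have "\<exists>v. stay_or_move G (last h) v \<and> \<not> forces_on G ?Q (c h) v"
      proof (rule ccontr)
        assume "\<nexists>v. stay_or_move G (last h) v \<and> \<not> forces_on G ?Q (c h) v"
        then have "forces_on G ?Q (c (butlast h)) (last h)"
          using h step[of h] by (intro forces.later[of "moves G" "c (butlast h)" "c h"]) auto
        then show False using h by blast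
      qed
      then obtain v where v: "stay_or_move G (last h) v" "\<not> forces_on G ?Q (c h) v" by blast
      then show "\<exists>h'. ?P (Suc n) h' \<and> (\<exists>v. h' = h @ [v])"
        using h legal_history_snoc[OF G(1) _ v(1)] by (intro exI[of _ "h @ [v]"]) auto
    qed
    then obtain h where h: "\<And>n. ?P n (h n)" "\<And>n. \<exists>v. h (Suc n) = h n @ [v]" by blast
    define p where "p n = last (h n)" for n
    have hp: "h n = map p [0..<Suc n]" for n
    proof (induction n)
      case 0
      have "length (h 0) = 1" using h(1)[of 0] by simp
      then show ?case by (cases "h 0") (auto simp: p_def)
    next
      case (Suc n)
      obtain v where v: "h (Suc n) = h n @ [v]" using h(2) by blast
      then have "p (Suc n) = v" by (simp add: p_def)
      then show ?case using v Suc by simp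
    qed
    have "legal_play G p"
      unfolding legal_play_def
    proof (intro conjI allI)
      have "legal_history G (h 0)" using h(1) by blast
      then show "p 0 \<in> pverts G" by (auto simp: hp legal_history_def)
      fix n
      have "legal_history G (h (Suc n))" using h(1) by blast
      then have "stay_or_move G (h (Suc n) ! n) (h (Suc n) ! Suc n)"
        using h(1)[of "Suc n"] unfolding legal_history_def by (metis lessI)
      then show "stay_or_move G (p n) (p (Suc n))"
        by (simp add: hp nth_append del: upt_Suc)
    qed
    then obtain n i where "i < k" "stay_or_move G (team_conf \<sigma> p n ! i) (p n)"
      using reach by blast
    then have "?Q (c (map p [0..<n])) (p n)" by (auto simp: c_def team_conf_def)
    moreover have "\<not> forces_on G ?Q (c (map p [0..<n])) (p n)"
      using h(1)[of n] unfolding hp by simp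
    ultimately show False by (simp add: forces.now)
  qed
  moreover have "c [] i \<in> pverts G" for i
    using legal_strategy_start[OF \<sigma> G(2)] z by (simp add: c_def)
  ultimately show ?thesis unfolding pursuit_def by blast
qed

text \<open>A cop on the robber's vertex after the robber's turn can stay there, and a cop that
  captures on its own turn could make that step just before it.\<close>

lemma pursuit_cops:
  assumes G: "pair_graph G" "pverts G \<noteq> {}" and "cops_win G k"
  shows "pursuit G k"
proof -
  from assms(3) obtain \<sigma> where \<sigma>: "legal_strategy G k \<sigma>"
    and win: "\<And>p. legal_play G p \<Longrightarrow>
      \<exists>n. p n \<in> set (team_conf \<sigma> p n) \<or> p n \<in> set (team_conf \<sigma> p (Suc n))"
    unfolding cops_win_def by blast
  show ?thesis
  proof (rule pursuit_if_strategy[OF G \<sigma>])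
    fix p assume p: "legal_play G p"
    have len: "length (team_conf \<sigma> p n) = k" for n by (rule legal_strategy_length[OF \<sigma> p])
    have verts: "p n \<in> pverts G" for n
      using p by (auto simp: legal_play_def stay_or_move_def)
    from win[OF p] obtain n where
      "p n \<in> set (team_conf \<sigma> p n) \<or> p n \<in> set (team_conf \<sigma> p (Suc n))" by blast
    then have "\<exists>i<k. stay_or_move G (team_conf \<sigma> p n ! i) (p n)"
    proof
      assume "p n \<in> set (team_conf \<sigma> p n)"
      then show ?thesis using stay_or_move_refl[OF verts, of n] by (auto simp: in_set_conv_nth len)
    next
      assume "p n \<in> set (team_conf \<sigma> p (Suc n))"
      then obtain i where "i < k" "team_conf \<sigma> p (Suc n) ! i = p n"
        by (auto simp: in_set_conv_nth len)
      then show ?thesis using legal_strategy_step[OF \<sigma> p, of i n] by auto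
    qed
    then show "\<exists>n. \<exists>i<k. stay_or_move G (team_conf \<sigma> p n ! i) (p n)" ..
  qed
qed

text \<open>On a single vertex no bodyguard may be needed, but a capture takes a token, hence
  \<open>max 1 k\<close>. On a larger connected graph every vertex has a neighbour, so surrounding
  the president yields an occupied vertex near his next one.\<close>

lemma pursuit_bodyguards:
  assumes G: "pair_graph G" "Digraph_Component.connected (with_proj G)" and "bodyguards_win G k"
  shows "pursuit G (max 1 k)"
proof (cases "\<exists>z. pverts G = {z}")
  case True
  then obtain z where z: "pverts G = {z}" by blast
  show ?thesis
    unfolding pursuit_def
    by (intro exI[of _ "\<lambda>_. z"] conjI ballI forces.now exI[of _ 0])
      (auto simp: z stay_or_move_def)
next
  case False
  have ne: "pverts G \<noteq> {}" using connected_nonempty[OF G(2)] .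
  from assms(3) obtain \<sigma> where \<sigma>: "legal_strategy G k \<sigma>"
    and win: "\<And>p. legal_play G p \<Longrightarrow> \<exists>N. \<forall>n\<ge>N. surrounded G (p n) (team_conf \<sigma> p (Suc n))"
    unfolding bodyguards_win_def by blast
  have nb: "\<exists>w. (u, w) \<in> parcs G" if u: "u \<in> pverts G" for u
  proof -
    obtain v where "v \<in> pverts G" "v \<noteq> u" using False u by blast
    then show ?thesis using connected_rtrancl[OF G u, of v] by (auto elim: converse_rtranclE)
  qed
  have "pursuit G k"
  proof (rule pursuit_if_strategy[OF G(1) ne \<sigma>])
    fix p assume p: "legal_play G p"
    have len: "length (team_conf \<sigma> p n) = k" for n by (rule legal_strategy_length[OF \<sigma> p])
    from win[OF p] obtain n where n: "surrounded G (p n) (team_conf \<sigma> p (Suc n))" by blast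
    have som: "stay_or_move G (p n) (p (Suc n))" using p by (simp add: legal_play_def)
    note verts = stay_or_move_verts[OF G(1) som]
    \<comment> \<open>If he stays, any neighbour serves as \<open>w\<close>; if he moves, his new
      vertex is itself an occupied neighbour of the old one.\<close>
    have "\<exists>w. (p n, w) \<in> parcs G \<and> stay_or_move G w (p (Suc n))"
    proof (cases "p (Suc n) = p n")
      case True
      from nb[OF verts(1)] obtain w where w: "(p n, w) \<in> parcs G" by blast
      then show ?thesis using True parcs_sym[OF G(1) w] parcs_verts[OF G(1) w]
        by (auto simp: stay_or_move_def)
    next
      case False
      then show ?thesis using som verts by (auto simp: stay_or_move_def)
    qed
    then obtain w where "w \<in> set (team_conf \<sigma> p (Suc n))" "stay_or_move G w (p (Suc n))"
      using n by (auto simp: surrounded_def)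
    then have "\<exists>i<k. stay_or_move G (team_conf \<sigma> p (Suc n) ! i) (p (Suc n))"
      by (auto simp: in_set_conv_nth len)
    then show "\<exists>n. \<exists>i<k. stay_or_move G (team_conf \<sigma> p n ! i) (p n)" ..
  qed
  then obtain f where "\<And>i. f i \<in> pverts G"
    and f: "\<And>u. u \<in> pverts G \<Longrightarrow> forces_on G (\<lambda>f u. \<exists>i<k. stay_or_move G (f i) u) f u"
    unfolding pursuit_def by blast
  moreover have "forces_on G (\<lambda>f u. \<exists>i<max 1 k. stay_or_move G (f i) u) f u"
    if "u \<in> pverts G" for u
    using f[OF that] by (rule forces_mono) auto
  ultimately show ?thesis unfolding pursuit_def by blast
qed

text \<open>The current vertex of the president counts as his placement, and token \<open>i\<close>
  of \<open>A\<close> plays bodyguard \<open>r i\<close>. Several tokens may play the same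
  bodyguard: one \<open>j\<close> then puts all of them on \<open>w\<close>, as the pairs of roles
  in the product require.\<close>

lemma wins_restart_bodyguards:
  assumes G: "pair_graph G" and \<sigma>: "legal_strategy G k \<sigma>"
    and win: "\<And>p. legal_play G p \<Longrightarrow> \<exists>N. \<forall>n\<ge>N. surrounded G (p n) (team_conf \<sigma> p (Suc n))"
    and sh: "shadowed G S f u" and A: "A \<inter> S = {}"
    and r: "\<And>i. i \<in> A \<Longrightarrow> r i < k" "\<And>i. i \<in> A \<Longrightarrow> f i = \<sigma> [] ! r i"
  shows "wins_on G (\<lambda>u f. (\<forall>i\<in>S. f i = u) \<and>
    (\<forall>w. (u, w) \<in> parcs G \<longrightarrow> (\<exists>j<k. \<forall>i\<in>A. r i = j \<longrightarrow> f i = w))) f u"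
  unfolding wins_def
proof (intro exI allI impI)
  let ?\<tau> = "\<lambda>h i. if i \<in> S then last h else if i \<in> A then \<sigma> h ! r i else f i"
  fix p assume p0: "p 0 = u" and p: "\<forall>n. stay_or_move G (p n) (p (Suc n))"
  have lp: "legal_play G p" using p0 p sh by (auto simp: legal_play_def shadowed_def)
  have len: "length (team_conf \<sigma> p n) = k" for n by (rule legal_strategy_length[OF \<sigma> lp])
  have f: "f i \<in> pverts G" for i using sh by (auto simp: shadowed_def)
  have "moves G f (?\<tau> [u])"
    using sh legal_strategy_step[OF \<sigma> lp, of _ 0] r p0
    by (auto simp: moves_def shadowed_def team_conf_def stay_or_move_refl)
  moreover have "moves G (?\<tau> (map p [0..<Suc n])) (?\<tau> (map p [0..<Suc (Suc n)]))" for n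
  proof -
    have "stay_or_move G (\<sigma> (map p [0..<Suc n]) ! r i) (\<sigma> (map p [0..<Suc (Suc n)]) ! r i)"
      if "i \<in> A" for i
      using legal_strategy_step[OF \<sigma> lp r(1)[OF that], of "Suc n"] by (simp only: team_conf_def)
    then show ?thesis using p f by (auto simp: moves_def stay_or_move_refl)
  qed
  moreover from win[OF lp] obtain N where
    N: "\<And>n. n \<ge> N \<Longrightarrow> surrounded G (p n) (team_conf \<sigma> p (Suc n))" by blast
  have "(\<forall>i\<in>S. ?\<tau> (map p [0..<Suc n]) i = p n) \<and> (\<forall>w. (p n, w) \<in> parcs G \<longrightarrow>
      (\<exists>j<k. \<forall>i\<in>A. r i = j \<longrightarrow> ?\<tau> (map p [0..<Suc n]) i = w))" if n: "n \<ge> N" for n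
  proof (intro conjI allI impI)
    fix w assume "(p n, w) \<in> parcs G"
    then have "w \<in> set (team_conf \<sigma> p (Suc n))" using N[OF n] by (auto simp: surrounded_def)
    then obtain j where "j < k" "team_conf \<sigma> p (Suc n) ! j = w" by (auto simp: in_set_conv_nth len)
    then show "\<exists>j<k. \<forall>i\<in>A. r i = j \<longrightarrow> ?\<tau> (map p [0..<Suc n]) i = w"
      using A by (intro exI[of _ j]) (auto simp: team_conf_def)
  qed simp
  ultimately show "moves G f (?\<tau> [u]) \<and>
      (\<forall>n. moves G (?\<tau> (map p [0..<Suc n])) (?\<tau> (map p [0..<Suc (Suc n)]))) \<and>
      (\<exists>N. \<forall>n\<ge>N. (\<forall>i\<in>S. ?\<tau> (map p [0..<Suc n]) i = p n) \<and>
        (\<forall>w. (p n, w) \<in> parcs G \<longrightarrow>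
          (\<exists>j<k. \<forall>i\<in>A. r i = j \<longrightarrow> ?\<tau> (map p [0..<Suc n]) i = w)))"
    by blast
qed

lemma bodyguards_win_if_wins_on:
  assumes c: "\<And>i. c i \<in> pverts G"
    and w: "\<And>u. u \<in> pverts G \<Longrightarrow> wins_on G (\<lambda>u f. surrounded G u (map f [0..<k])) c u"
  shows "bodyguards_win G k"
proof -
  have "\<exists>T. \<forall>u\<in>pverts G. \<forall>p. p 0 = u \<longrightarrow> (\<forall>n. stay_or_move G (p n) (p (Suc n))) \<longrightarrow>
     moves G c (T u [u]) \<and>
     (\<forall>n. moves G (T u (map p [0..<Suc n])) (T u (map p [0..<Suc (Suc n)]))) \<and>
     (\<exists>N. \<forall>n\<ge>N. surrounded G (p n) (map (T u (map p [0..<Suc n])) [0..<k]))"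
    using w unfolding wins_def by (intro bchoice) blast
  then obtain T where T: "\<And>p. p 0 \<in> pverts G \<Longrightarrow> (\<And>n. stay_or_move G (p n) (p (Suc n))) \<Longrightarrow>
     moves G c (T (p 0) [p 0]) \<and>
     (\<forall>n. moves G (T (p 0) (map p [0..<Suc n])) (T (p 0) (map p [0..<Suc (Suc n)]))) \<and>
     (\<exists>N. \<forall>n\<ge>N. surrounded G (p n) (map (T (p 0) (map p [0..<Suc n])) [0..<k]))"
    by metis
  \<comment> \<open>The empty history yields the placement \<open>c\<close>; afterwards the
    president's placement \<open>hd h\<close> selects the strategy. Only the first \<open>k\<close>
    tokens are kept.\<close>
  define \<sigma> where "\<sigma> h = map (if h = [] then c else T (hd h) h) [0..<k]" for h
  have conf0: "team_conf \<sigma> p 0 = map c [0..<k]" for p by (simp add: team_conf_def \<sigma>_def)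
  have confS: "team_conf \<sigma> p (Suc n) = map (T (p 0) (map p [0..<Suc n])) [0..<k]" for p n
  proof -
    have "hd (map p [0..<Suc n]) = p 0" by (subst map_upt_Suc_shift) simp
    then show ?thesis by (simp add: team_conf_def \<sigma>_def del: upt_Suc)
  qed
  have lift: "list_all2 (stay_or_move G) (map f [0..<k]) (map g [0..<k])" if "moves G f g" for f g
    using that by (auto simp: moves_def list_all2_conv_all_nth)
  have "legal_strategy G k \<sigma>"
    unfolding legal_strategy_def
  proof (intro allI impI conjI)
    fix p assume p: "legal_play G p"
    show "length (team_conf \<sigma> p 0) = k" "set (team_conf \<sigma> p 0) \<subseteq> pverts G"
      using c by (auto simp: conf0)
    fix n
    show "list_all2 (stay_or_move G) (team_conf \<sigma> p n) (team_conf \<sigma> p (Suc n))"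
    proof (cases n)
      case 0
      then show ?thesis using T[of p] p confS[of p 0]
        by (auto simp: conf0 legal_play_def intro!: lift)
    next
      case (Suc l)
      then show ?thesis using T[of p] p
        by (auto simp: confS legal_play_def intro!: lift simp del: upt_Suc)
    qed
  qed
  moreover have "\<exists>N. \<forall>n\<ge>N. surrounded G (p n) (team_conf \<sigma> p (Suc n))" if "legal_play G p" for p
    using T[of p] that by (auto simp: confS legal_play_def simp del: upt_Suc)
  ultimately show ?thesis unfolding bodyguards_win_def by blast
qed

section \<open>Attainment of the two minima, and positivity of pursuits\<close>

lemma bodyguards_win_bodyguard_number:
  assumes "pair_graph G" shows "bodyguards_win G (bodyguard_number G)"
proof -
  interpret pair_graph G by fact
  obtain vs where vs: "set vs = pverts G" using finite_list[OF pair_finite_verts] by blast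
  \<comment> \<open>Tokens that occupy all vertices for ever surround the president everywhere, so
    the least number exists.\<close>
  have "bodyguards_win G (length vs)"
    unfolding bodyguards_win_def legal_strategy_def team_conf_def surrounded_def
    using vs parcs_verts[OF assms]
    by (intro exI[of _ "\<lambda>_. vs"]) (auto intro!: list.rel_refl_strong stay_or_move_refl)
  then show ?thesis unfolding bodyguard_number_def by (rule LeastI)
qed

lemma cops_win_cop_number:
  assumes "pair_graph G" shows "cops_win G (cop_number G)"
proof -
  interpret pair_graph G by fact
  obtain vs where vs: "set vs = pverts G" using finite_list[OF pair_finite_verts] by blast
  have "cops_win G (length vs)"
    unfolding cops_win_def legal_strategy_def team_conf_def
    using vs
    by (intro exI[of _ "\<lambda>_. vs"])
      (auto simp: legal_play_def intro!: list.rel_refl_strong stay_or_move_refl)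
  then show ?thesis unfolding cop_number_def by (rule LeastI)
qed

lemma pursuit_pos:
  assumes "pursuit G d" "pverts G \<noteq> {}" shows "d > 0"
proof (rule ccontr)
  assume "\<not> ?thesis"
  then obtain f u where "u \<in> pverts G" and
    "forces_on G (\<lambda>f u. \<exists>i<0. stay_or_move G (f i) u) f u"
    using assms by (auto simp: pursuit_def)
  from this(2,1) show False by induction (auto intro: stay_or_move_refl)
qed

section \<open>Two games played in parallel\<close>

lemma stay_or_move_strong_product:
  "stay_or_move (G \<boxtimes> H) x y \<longleftrightarrow> stay_or_move G (fst x) (fst y) \<and> stay_or_move H (snd x) (snd y)"
  by (cases x; cases y) (auto simp: stay_or_move_def strong_product_def)

lemma moves_strong_product:
  "moves (G \<boxtimes> H) F F' \<longleftrightarrow> moves G (fst \<circ> F) (fst \<circ> F') \<and> moves H (snd \<circ> F) (snd \<circ> F')"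
  by (auto simp: moves_def stay_or_move_strong_product)

text \<open>Moves in the product are independent pairs of moves: the team forces \<open>Q\<close> in
  the first coordinate and preserves in the second an invariant \<open>J\<close> that it can
  maintain against every reply.\<close>

lemma forces_on_fst:
  fixes F :: "nat \<Rightarrow> 'a \<times> 'b"
  assumes "forces_on G Q (fst \<circ> F) (fst U)" and "J (snd \<circ> F) (snd U)"
    and J: "\<And>g v. J g v \<Longrightarrow> \<exists>g'. moves H g g' \<and> (\<forall>v'. stay_or_move H v v' \<longrightarrow> J g' v')"
  shows "forces_on (G \<boxtimes> H) (\<lambda>F U. Q (fst \<circ> F) (fst U) \<and> J (snd \<circ> F) (snd U)) F U"
proof -
  have "forces_on (G \<boxtimes> H) (\<lambda>F U. \<exists>f u. Q f u \<and> f = fst \<circ> F \<and> u = fst U \<and> J (snd \<circ> F) (snd U)) F U"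
    using assms(1)
  proof (rule forces_simulation)
    fix F :: "nat \<Rightarrow> 'a \<times> 'b" and U :: "'a \<times> 'b" and f u f'
    assume *: "f = fst \<circ> F \<and> u = fst U \<and> J (snd \<circ> F) (snd U)" and f': "moves G f f'"
    then obtain g' where g': "moves H (snd \<circ> F) g'" "\<forall>v'. stay_or_move H (snd U) v' \<longrightarrow> J g' v'"
      using J by blast
    show "\<exists>F'. moves (G \<boxtimes> H) F F' \<and> (\<forall>U'. stay_or_move (G \<boxtimes> H) U U' \<longrightarrow>
        (\<exists>u'. stay_or_move G u u' \<and> f' = fst \<circ> F' \<and> u' = fst U' \<and> J (snd \<circ> F') (snd U')))"
      using * f' g'
      by (intro exI[of _ "\<lambda>i. (f' i, g' i)"])
        (auto simp: moves_strong_product stay_or_move_strong_product comp_def)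
  qed (use assms(2) in simp)
  then show ?thesis by (rule forces_mono) auto
qed

lemma forces_on_snd:
  fixes F :: "nat \<Rightarrow> 'a \<times> 'b"
  assumes "forces_on H Q (snd \<circ> F) (snd U)" and "J (fst \<circ> F) (fst U)"
    and J: "\<And>f u. J f u \<Longrightarrow> \<exists>f'. moves G f f' \<and> (\<forall>u'. stay_or_move G u u' \<longrightarrow> J f' u')"
  shows "forces_on (G \<boxtimes> H) (\<lambda>F U. Q (snd \<circ> F) (snd U) \<and> J (fst \<circ> F) (fst U)) F U"
proof -
  have "forces_on (G \<boxtimes> H) (\<lambda>F U. \<exists>g v. Q g v \<and> g = snd \<circ> F \<and> v = snd U \<and> J (fst \<circ> F) (fst U)) F U"
    using assms(1)
  proof (rule forces_simulation)
    fix F :: "nat \<Rightarrow> 'a \<times> 'b" and U :: "'a \<times> 'b" and g v g'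
    assume *: "g = snd \<circ> F \<and> v = snd U \<and> J (fst \<circ> F) (fst U)" and g': "moves H g g'"
    then obtain f' where f': "moves G (fst \<circ> F) f'" "\<forall>u'. stay_or_move G (fst U) u' \<longrightarrow> J f' u'"
      using J by blast
    show "\<exists>F'. moves (G \<boxtimes> H) F F' \<and> (\<forall>U'. stay_or_move (G \<boxtimes> H) U U' \<longrightarrow>
        (\<exists>v'. stay_or_move H v v' \<and> g' = snd \<circ> F' \<and> v' = snd U' \<and> J (fst \<circ> F') (fst U')))"
      using * f' g'
      by (intro exI[of _ "\<lambda>i. (f' i, g' i)"])
        (auto simp: moves_strong_product stay_or_move_strong_product comp_def)
  qed (use assms(2) in simp)
  then show ?thesis by (rule forces_mono) auto
qed

lemma wins_on_strong_product:
  assumes "wins_on G R (fst \<circ> F) (fst U)" "wins_on H R' (snd \<circ> F) (snd U)"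
  shows "wins_on (G \<boxtimes> H) (\<lambda>U F. R (fst U) (fst \<circ> F) \<and> R' (snd U) (snd \<circ> F)) F U"
proof -
  from assms(1) obtain s where s: "\<And>p. p 0 = fst U \<Longrightarrow> (\<And>n. stay_or_move G (p n) (p (Suc n))) \<Longrightarrow>
     moves G (fst \<circ> F) (s [fst U]) \<and>
     (\<forall>n. moves G (s (map p [0..<Suc n])) (s (map p [0..<Suc (Suc n)]))) \<and>
     (\<exists>N. \<forall>n\<ge>N. R (p n) (s (map p [0..<Suc n])))"
    unfolding wins_def by blast
  from assms(2) obtain t where t: "\<And>p. p 0 = snd U \<Longrightarrow> (\<And>n. stay_or_move H (p n) (p (Suc n))) \<Longrightarrow>
     moves H (snd \<circ> F) (t [snd U]) \<and>
     (\<forall>n. moves H (t (map p [0..<Suc n])) (t (map p [0..<Suc (Suc n)]))) \<and>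
     (\<exists>N. \<forall>n\<ge>N. R' (p n) (t (map p [0..<Suc n])))"
    unfolding wins_def by blast
  define \<tau> where "\<tau> h = (\<lambda>i. (s (map fst h) i, t (map snd h) i))" for h
  have proj: "fst \<circ> \<tau> h = s (map fst h)" "snd \<circ> \<tau> h = t (map snd h)" for h
    by (auto simp: \<tau>_def)
  show ?thesis
    unfolding wins_def
  proof (intro exI[of _ \<tau>] allI impI)
    fix p assume p0: "p 0 = U" and p: "\<forall>n. stay_or_move (G \<boxtimes> H) (p n) (p (Suc n))"
    have s': "moves G (fst \<circ> F) (s [fst U])"
      "\<And>n. moves G (s (map (fst \<circ> p) [0..<Suc n])) (s (map (fst \<circ> p) [0..<Suc (Suc n)]))"
      "\<exists>N. \<forall>n\<ge>N. R (fst (p n)) (s (map (fst \<circ> p) [0..<Suc n]))"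
      using s[of "fst \<circ> p"] p0 p by (auto simp: stay_or_move_strong_product simp del: upt_Suc)
    have t': "moves H (snd \<circ> F) (t [snd U])"
      "\<And>n. moves H (t (map (snd \<circ> p) [0..<Suc n])) (t (map (snd \<circ> p) [0..<Suc (Suc n)]))"
      "\<exists>N. \<forall>n\<ge>N. R' (snd (p n)) (t (map (snd \<circ> p) [0..<Suc n]))"
      using t[of "snd \<circ> p"] p0 p by (auto simp: stay_or_move_strong_product simp del: upt_Suc)
    from s'(3) t'(3) obtain N M where
      "\<And>n. n \<ge> N \<Longrightarrow> R (fst (p n)) (s (map (fst \<circ> p) [0..<Suc n]))"
      "\<And>n. n \<ge> M \<Longrightarrow> R' (snd (p n)) (t (map (snd \<circ> p) [0..<Suc n]))" by blast
    then have "\<exists>N. \<forall>n\<ge>N. R (fst (p n)) (fst \<circ> \<tau> (map p [0..<Suc n])) \<and>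
        R' (snd (p n)) (snd \<circ> \<tau> (map p [0..<Suc n]))"
      by (intro exI[of _ "max N M"]) (simp add: proj del: upt_Suc)
    then show "moves (G \<boxtimes> H) F (\<tau> [U]) \<and>
        (\<forall>n. moves (G \<boxtimes> H) (\<tau> (map p [0..<Suc n])) (\<tau> (map p [0..<Suc (Suc n)]))) \<and>
        (\<exists>N. \<forall>n\<ge>N. R (fst (p n)) (fst \<circ> \<tau> (map p [0..<Suc n])) \<and>
          R' (snd (p n)) (snd \<circ> \<tau> (map p [0..<Suc n])))"
      using s'(1,2) t'(1,2) by (simp add: moves_strong_product proj del: upt_Suc)
  qed
qed

section \<open>Assigning the roles in the strong product\<close>

text \<open>Here \<open>c\<close> and \<open>d\<close> are sizes of hunting parties in the two
  factors. Assumption \<open>n\<close> states the bound without subtraction; \<open>cd\<close> says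
  that, unless no shadows in \<open>H\<close> are wanted, the tokens that do not shadow in
  \<open>G\<close> suffice to recruit them.\<close>

lemma bodyguards_win_strong_product:
  assumes G: "pair_graph G" "Digraph_Component.connected (with_proj G)"
    and H: "pair_graph H" "Digraph_Component.connected (with_proj H)"
    and k: "bodyguards_win G k" and m: "bodyguards_win H m"
    and c: "pursuit G c" and d: "pursuit H d"
    and n: "k * m + k + m + c \<le> n + 1" and cd: "k = 0 \<or> d \<le> k * m + c"
  shows "bodyguards_win (G \<boxtimes> H) n"
proof -
  from k obtain \<sigma> where \<sigma>: "legal_strategy G k \<sigma>"
    and win\<sigma>: "\<And>p. legal_play G p \<Longrightarrow> \<exists>N. \<forall>n\<ge>N. surrounded G (p n) (team_conf \<sigma> p (Suc n))"
    unfolding bodyguards_win_def by blast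
  from m obtain \<rho> where \<rho>: "legal_strategy H m \<rho>"
    and win\<rho>: "\<And>p. legal_play H p \<Longrightarrow> \<exists>N. \<forall>n\<ge>N. surrounded H (p n) (team_conf \<rho> p (Suc n))"
    unfolding bodyguards_win_def by blast
  note neG = connected_nonempty[OF G(2)] and neH = connected_nonempty[OF H(2)]
  have km: "k * m + k + m \<le> n" using n pursuit_pos[OF c neG] by linarith
  let ?GH = "G \<boxtimes> H"
  let ?R = "\<lambda>U F. surrounded ?GH U (map F [0..<n])"
  \<comment> \<open>The second phase starts here: \<open>S1\<close> already shadows in
    \<open>G\<close> and \<open>S2\<close> in \<open>H\<close>.\<close>
  have roles: "wins_on ?GH ?R F U"
    if S1: "S1 \<subseteq> {..<n}" "card S1 = m" "shadowed G S1 (fst \<circ> F) (fst U)"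
      and S2: "S2 \<subseteq> {..<n} - S1" "card S2 = k" "shadowed H S2 (snd \<circ> F) (snd U)"
    for S1 S2 F U
  proof -
    have fin: "finite S1" "finite S2" using S1(1) S2(1) by (auto intro: finite_subset)
    have "card ({..<n} - S1 - S2) = n - m - k"
      using S1 S2 fin by (simp add: card_Diff_subset)
    then have "k * m \<le> card ({..<n} - S1 - S2)" using km by simp
    then obtain S3 where S3: "S3 \<subseteq> {..<n} - S1 - S2" "card S3 = k * m" "finite S3"
      using obtain_subset_with_card_n by metis
    obtain b1 where b1: "bij_betw b1 S1 {..<m}"
      using ex_bij_betw_finite_nat[OF fin(1)] S1(2) by (auto simp: atLeast0LessThan)
    obtain b2 where b2: "bij_betw b2 S2 {..<k}"
      using ex_bij_betw_finite_nat[OF fin(2)] S2(2) by (auto simp: atLeast0LessThan)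
    obtain b3 where b3: "bij_betw b3 S3 ({..<k} \<times> {..<m})"
      using finite_same_card_bij[OF S3(3), of "{..<k} \<times> {..<m}"] S3(2) by auto
    have disj: "S1 \<inter> S2 = {}" "S1 \<inter> S3 = {}" "S2 \<inter> S3 = {}" using S2(1) S3(1) by auto
    \<comment> \<open>\<open>r\<close> is the role in the game on \<open>G\<close>, meaningful on
      \<open>S2\<close> and \<open>S3\<close>; \<open>s\<close> is the role in the game on
      \<open>H\<close>, meaningful on \<open>S1\<close> and \<open>S3\<close>. On \<open>S3\<close>
      they are the components of \<open>b3\<close>.\<close>
    define r where "r i = (if i \<in> S2 then b2 i else fst (b3 i))" for i
    define s where "s i = (if i \<in> S1 then b1 i else snd (b3 i))" for i
    have r: "r i < k" if "i \<in> S2 \<union> S3" for i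
      using that bij_betw_apply[OF b2] bij_betw_apply[OF b3] by (fastforce simp: r_def)
    have s: "s i < m" if "i \<in> S1 \<union> S3" for i
      using that bij_betw_apply[OF b1] bij_betw_apply[OF b3] by (fastforce simp: s_def)
    let ?PG = "\<lambda>f u. shadowed G S1 f u \<and> (\<forall>i\<in>S2 \<union> S3. f i = \<sigma> [] ! r i)"
    let ?PH = "\<lambda>g v. shadowed H S2 g v \<and> (\<forall>i\<in>S1 \<union> S3. g i = \<rho> [] ! s i)"
    have "forces_on G ?PG (fst \<circ> F) (fst U)"
      using S1(3) fin S3(3) disj r legal_strategy_start[OF \<sigma> neG]
      by (intro forces_relocate[OF G]) blast+
    then have "forces_on ?GH (\<lambda>F U. ?PG (fst \<circ> F) (fst U) \<and> shadowed H S2 (snd \<circ> F) (snd U)) F U"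
      using S2(3) by (rule forces_on_fst) (use shadowed_maintain[OF H(1)] in blast)
    then have "forces_on ?GH (\<lambda>F U. ?PH (snd \<circ> F) (snd U) \<and> ?PG (fst \<circ> F) (fst U)) F U"
    proof (rule forces_trans)
      fix F U assume *: "?PG (fst \<circ> F) (fst U) \<and> shadowed H S2 (snd \<circ> F) (snd U)"
      show "forces_on ?GH (\<lambda>F U. ?PH (snd \<circ> F) (snd U) \<and> ?PG (fst \<circ> F) (fst U)) F U"
      proof (rule forces_on_snd[where J = ?PG])
        show "forces_on H ?PH (snd \<circ> F) (snd U)"
          using * fin S3(3) disj s legal_strategy_start[OF \<rho> neH]
          by (intro forces_relocate[OF H]) blast+
        show "?PG (fst \<circ> F) (fst U)" using * by blast
        \<comment> \<open>While tokens are relocated in \<open>H\<close>, the first coordinates of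
          \<open>S2\<close> and \<open>S3\<close> rest at their starting positions, because only
          \<open>S1\<close> moves in \<open>G\<close>.\<close>
        fix f u assume f: "?PG f u"
        from shadowed_maintain[OF G(1)] f obtain f' where "moves G f f'"
          and f': "\<And>i. i \<notin> S1 \<Longrightarrow> f' i = f i" "\<forall>u'. stay_or_move G u u' \<longrightarrow> shadowed G S1 f' u'"
          by blast
        moreover have "\<forall>i\<in>S2 \<union> S3. f' i = \<sigma> [] ! r i" using f f'(1) disj by (metis Un_iff disjoint_iff)
        ultimately show "\<exists>f'. moves G f f' \<and> (\<forall>u'. stay_or_move G u u' \<longrightarrow> ?PG f' u')" by blast
      qed
    qed
    then show ?thesis
    proof (rule forces_wins)
      fix F U assume *: "?PH (snd \<circ> F) (snd U) \<and> ?PG (fst \<circ> F) (fst U)"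
      let ?RG = "\<lambda>u f. (\<forall>i\<in>S1. f i = u) \<and>
        (\<forall>w. (u, w) \<in> parcs G \<longrightarrow> (\<exists>j<k. \<forall>i\<in>S2 \<union> S3. r i = j \<longrightarrow> f i = w))"
      let ?RH = "\<lambda>v g. (\<forall>i\<in>S2. g i = v) \<and>
        (\<forall>w. (v, w) \<in> parcs H \<longrightarrow> (\<exists>j<m. \<forall>i\<in>S1 \<union> S3. s i = j \<longrightarrow> g i = w))"
      have "wins_on G ?RG (fst \<circ> F) (fst U)"
        using * disj r by (intro wins_restart_bodyguards[OF G(1) \<sigma> win\<sigma>]) auto
      moreover have "wins_on H ?RH (snd \<circ> F) (snd U)"
        using * disj s by (intro wins_restart_bodyguards[OF H(1) \<rho> win\<rho>]) auto
      ultimately have "wins_on ?GH (\<lambda>U F. ?RG (fst U) (fst \<circ> F) \<and> ?RH (snd U) (snd \<circ> F)) F U"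
        by (rule wins_on_strong_product)
      then show "wins_on ?GH ?R F U"
      proof (rule wins_mono)
        fix U F assume RR: "?RG (fst U) (fst \<circ> F) \<and> ?RH (snd U) (snd \<circ> F)"
        obtain u v where U: "U = (u, v)" by fastforce
        have "(x, y) \<in> F ` {..<n}" if arc: "((u, v), (x, y)) \<in> parcs ?GH" for x y
        proof -
          have G_role: "\<exists>j<k. \<forall>i\<in>S2 \<union> S3. r i = j \<longrightarrow> fst (F i) = x" if "(u, x) \<in> parcs G"
            using RR that by (auto simp: U)
          have H_role: "\<exists>j<m. \<forall>i\<in>S1 \<union> S3. s i = j \<longrightarrow> snd (F i) = y" if "(v, y) \<in> parcs H"
            using RR that by (auto simp: U)
          consider (G) "(u, x) \<in> parcs G" "v = y" | (H) "u = x" "(v, y) \<in> parcs H"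
            | (GH) "(u, x) \<in> parcs G" "(v, y) \<in> parcs H"
            using arc by (auto simp: strong_product_def)
          then have "\<exists>i \<in> S1 \<union> S2 \<union> S3. F i = (x, y)"
          proof cases
            case G
            then obtain j where j: "j < k" "\<And>i. i \<in> S2 \<Longrightarrow> r i = j \<Longrightarrow> fst (F i) = x"
              using G_role by blast
            obtain i where i: "i \<in> S2" "b2 i = j"
              using b2 j(1) unfolding bij_betw_def by (metis imageE lessThan_iff)
            then have "F i = (x, y)" using j(2)[of i] RR G(2) by (auto simp: r_def U prod_eq_iff)
            then show ?thesis using i by blast
          next
            case H
            then obtain j where j: "j < m" "\<And>i. i \<in> S1 \<Longrightarrow> s i = j \<Longrightarrow> snd (F i) = y"
              using H_role by blast
            obtain i where i: "i \<in> S1" "b1 i = j"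
              using b1 j(1) unfolding bij_betw_def by (metis imageE lessThan_iff)
            then have "F i = (x, y)" using j(2)[of i] RR H(1) by (auto simp: s_def U prod_eq_iff)
            then show ?thesis using i by blast
          next
            case GH
            then obtain j l where jl: "j < k" "l < m"
              "\<And>i. i \<in> S3 \<Longrightarrow> r i = j \<Longrightarrow> fst (F i) = x" "\<And>i. i \<in> S3 \<Longrightarrow> s i = l \<Longrightarrow> snd (F i) = y"
              using G_role H_role by blast
            \<comment> \<open>The two games single out \<open>j\<close> and \<open>l\<close>
              independently, so a token for every pair is needed, and \<open>b3\<close> provides
              it.\<close>
            then have "(j, l) \<in> b3 ` S3" using b3 by (simp add: bij_betw_def)
            then obtain i where i: "i \<in> S3" "b3 i = (j, l)" by force
            then have "r i = j" "s i = l" using disj by (auto simp: r_def s_def)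
            then have "F i = (x, y)" using jl(3,4) i(1) by (auto simp: prod_eq_iff)
            then show ?thesis using i by blast
          qed
          moreover have "S1 \<union> S2 \<union> S3 \<subseteq> {..<n}" using S1(1) S2(1) S3(1) by blast
          ultimately show ?thesis by (metis imageI subsetD)
        qed
        then show "?R U F" by (auto simp: surrounded_def U atLeast0LessThan)
      qed
    qed
  qed
  obtain z where z: "z \<in> pverts ?GH" using neG neH by (auto simp: strong_product_def)
  show ?thesis
  proof (rule bodyguards_win_if_wins_on)
    fix U assume U: "U \<in> pverts ?GH"
    \<comment> \<open>All tokens may start on one vertex, since connectivity lets them go anywhere
      later.\<close>
    let ?F = "\<lambda>_ :: nat. z"
    have sh: "shadowed G {} (fst \<circ> ?F) (fst U)" "shadowed H {} (snd \<circ> ?F) (snd U)"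
      using U z by (auto simp: shadowed_def strong_product_def)
    let ?Q1 = "\<lambda>f u. \<exists>S\<subseteq>{..<n}. card S = m \<and> shadowed G S f u"
    have "forces_on G ?Q1 (fst \<circ> ?F) (fst U)"
      using sh(1) n by (intro forces_shadow_team[OF G c]) auto
    then have "forces_on ?GH (\<lambda>F U. ?Q1 (fst \<circ> F) (fst U) \<and> shadowed H {} (snd \<circ> F) (snd U)) ?F U"
      using sh(2) by (rule forces_on_fst) (use shadowed_maintain[OF H(1)] in blast)
    then show "wins_on ?GH ?R ?F U"
    proof (rule forces_wins)
      fix F U assume "?Q1 (fst \<circ> F) (fst U) \<and> shadowed H {} (snd \<circ> F) (snd U)"
      then obtain S1 where S1: "S1 \<subseteq> {..<n}" "card S1 = m" "shadowed G S1 (fst \<circ> F) (fst U)"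
        and sh: "shadowed H {} (snd \<circ> F) (snd U)" by blast
      let ?Q2 = "\<lambda>g v. \<exists>S\<subseteq>{..<n} - S1. card S = k \<and> shadowed H S g v"
      \<comment> \<open>By \<open>n\<close>, these \<open>n - m\<close> tokens number at least
        \<open>k * m + k + c - 1\<close>, so \<open>cd\<close> gives the \<open>k + d - 1\<close>
        that recruiting \<open>k\<close> shadows takes.\<close>
      have "card ({..<n} - S1) = n - m" using S1 by (simp add: card_Diff_subset finite_subset)
      then have "forces_on H ?Q2 (snd \<circ> F) (snd U)"
        using sh n cd km by (intro forces_shadow_team[OF H d]) auto
      then have "forces_on ?GH
          (\<lambda>F U. ?Q2 (snd \<circ> F) (snd U) \<and> shadowed G S1 (fst \<circ> F) (fst U)) F U"
        using S1(3) by (rule forces_on_snd) (use shadowed_maintain[OF G(1)] in blast)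
      then show "wins_on ?GH ?R F U"
        by (rule forces_wins) (use roles S1(1,2) in blast)
    qed
  qed (rule z)
qed

theorem theorem5p1:
  fixes G :: "'a pair_pre_digraph" and H :: "'b pair_pre_digraph"
  assumes "pair_graph G" and "pair_graph H"
    and "Digraph_Component.connected (with_proj G)"
    and "Digraph_Component.connected (with_proj H)"
    and "cop_number G \<le> cop_number H"
  shows "int (bodyguard_number (G \<boxtimes> H)) \<le>
    int (bodyguard_number G) * (int (bodyguard_number H) + 1) +
    int (bodyguard_number H) + int (cop_number G) - 1"
proof -
  let ?k = "bodyguard_number G" and ?m = "bodyguard_number H" and ?c = "cop_number G"
  \<comment> \<open>The truncated subtraction is exact, as \<open>c1\<close> below shows
    \<open>?c\<close> to be positive.\<close>
  let ?n = "?k * ?m + ?k + ?m + (?c - 1)"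
  note neG = connected_nonempty[OF assms(3)]
  note k = bodyguards_win_bodyguard_number[OF assms(1)]
    and m = bodyguards_win_bodyguard_number[OF assms(2)]
  have c: "pursuit G ?c" using pursuit_cops[OF assms(1) neG cops_win_cop_number[OF assms(1)]] .
  have c1: "?c \<ge> 1" using pursuit_pos[OF c neG] by simp
  \<comment> \<open>This is \<open>cd\<close> with \<open>d = max 1 ?m\<close>: for positive
    \<open>?k\<close> the product \<open>?k * ?m\<close> already covers \<open>?m\<close>, and
    \<open>?c\<close> covers \<open>1\<close>.\<close>
  have "?k = 0 \<or> max 1 ?m \<le> ?k * ?m + ?c" using c1 by (cases ?k) auto
  then have "bodyguards_win (G \<boxtimes> H) ?n"
    using c1 by (intro bodyguards_win_strong_product[OF assms(1,3,2,4) k m c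
      pursuit_bodyguards[OF assms(2,4) m]]) auto
  then have "bodyguard_number (G \<boxtimes> H) \<le> ?n"
    unfolding bodyguard_number_def by (rule Least_le)
  then have "int (bodyguard_number (G \<boxtimes> H)) \<le> int ?n" by linarith
  then show ?thesis using c1 by (simp add: of_nat_diff algebra_simps)
qed

end
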